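(* Suppose $\delta=\alpha=\beta$. Then the $p$-adic dynamical system generated by $f(x)=\frac{x^3+ax^2+bx}{ax+b}$ has the following properties. 1. (a) $SI(0)=U_\alpha(0)$. (b) $\mathcal{P}\subset S_\alpha(0)$. 2. For $x\in S_\alpha(0)\setminus\mathcal{P}$: (a) if $|f(x)|_p=\alpha$, then $f(x)\in S_\alpha(0)$; (b) if $|f(x)|_p<\alpha$, then $f^n(x)\in S_{|f(x)|_p}(0)$ for all $n\geq 1$. 3. If $r\geq\alpha$, $x\in S_r(0)\setminus\mathcal{P}$ and $|f(x)|_p>\alpha$, then $\lim_{n\to\infty}|f^n(x)|_p=+\infty$.
   Context: $p$ is a prime, $\mathbb{C}_p$ is the field of complex $p$-adic numbers with norm $|\cdot|_p$, and $a,b\in\mathbb{C}_p$ satisfy $ab\neq 0$. The function $f(x)=\frac{x^3+ax^2+bx}{ax+b}$ is defined for $x\in\mathbb{C}_p$, $x\neq\hat x:=-\frac{b}{a}$; its unique fixed point is $x_0=0$. Let $x_1,x_2=\frac{-a\pm\sqrt{a^2-4b}}{2}$ be the roots of $x^2+ax+b$ in $\mathbb{C}_p$ and put $\delta=|a|_p$, $\alpha=|x_1|_p$, $\beta=|x_2|_p$. $U_r(c)=\{x\in\mathbb{C}_p:|x-c|_p<r\}$, $S_r(c)=\{x\in\mathbb{C}_p:|x-c|_p=r\}$ (with $S_0(0)=\{0\}$). $\mathcal{P}=\{x\in\mathbb{C}_p:\exists n\in\mathbb{N}\cup\{0\},\ f^n(x)=\hat x\}$, where $f^n$ is the $n$-fold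 iterate. A sphere $S_\rho(0)$ is invariant for $f$ if $x\in S_\rho(0)$ implies that $f^n(x)$ is defined and lies in $S_\rho(0)$ for all $n\geq1$. The ball $U_r(0)$ is a Siegel disk if every sphere $S_\rho(0)$ with $\rho<r$ is invariant for $f$; $SI(0)$, the maximum Siegel disk, is the union of all Siegel disks centered at $0$. *)

theory Defs
  imports "HOL-Analysis.Analysis" "HOL-Computational_Algebra.Polynomial"
    "HOL-Computational_Algebra.Primes"
begin

section \<open>The field of complex p-adic numbers\<close>

definition padic_abs :: "nat \<Rightarrow> rat \<Rightarrow> real" where
  "padic_abs p q = (if q = 0 then 0 else
     (let (m, n) = quotient_of q in
        real p powi (int (multiplicity (int p) n) - int (multiplicity (int p) m))))"

locale nonarchimedean_field =
  fixes nrm :: "'a::field_char_0 \<Rightarrow> real"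
  assumes nrm_nonneg: "0 \<le> nrm x"
    and nrm_eq_0_iff: "nrm x = 0 \<longleftrightarrow> x = 0"
    and nrm_mult: "nrm (x * y) = nrm x * nrm y"
    and nrm_ultrametric: "nrm (x + y) \<le> max (nrm x) (nrm y)"
begin

lemma nrm_1: "nrm 1 = 1"
  using nrm_mult[of 1 1] nrm_eq_0_iff[of 1] by simp

lemma nrm_minus: "nrm (- x) = nrm x"
proof -
  have "(nrm (- 1))\<^sup>2 = 1"
    using nrm_mult[of "- 1" "- 1"] nrm_1 by (simp add: power2_eq_square)
  then have "nrm (- 1) = 1"
    using nrm_nonneg[of "- 1"] by (simp add: power2_eq_1_iff)
  then show ?thesis
    using nrm_mult[of "- 1" x] by simp
qed

sublocale Metric_space UNIV "\<lambda>x y. nrm (x - y)"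
proof
  fix x y z :: 'a
  show "0 \<le> nrm (x - y)" by (rule nrm_nonneg)
  show "nrm (x - y) = nrm (y - x)" using nrm_minus[of "x - y"] by simp
  show "nrm (x - y) = 0 \<longleftrightarrow> x = y" by (simp add: nrm_eq_0_iff)
  show "nrm (x - z) \<le> nrm (x - y) + nrm (y - z)"
    using nrm_ultrametric[of "x - y" "y - z"] nrm_nonneg[of "x - y"] nrm_nonneg[of "y - z"]
    by simp
qed

text \<open>If \<open>nrm\<close> is complete and extends the p-adic absolute value, the closure of the
  rational numbers is a copy of the field of p-adic numbers.\<close>

definition rat_closure :: "'a set" where
  "rat_closure = mtopology closure_of (range of_rat)"

definition algebraic_elements :: "'a set" where
  "algebraic_elements =
     {x. \<exists>q. q \<noteq> 0 \<and> (\<forall>i. coeff q i \<in> rat_closure) \<and> poly q x = 0}"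

end

text \<open>A field is (a copy of) the field of complex p-adic numbers if it is the completion of an
  algebraic closure of the p-adic numbers: the algebraic elements over the p-adic numbers
  form an algebraically closed field, they are dense, and the whole field is complete.
  This determines the valued field up to isometric isomorphism.\<close>

locale complex_padic_field = nonarchimedean_field nrm
  for p :: nat and nrm :: "'a::field_char_0 \<Rightarrow> real" +
  assumes prime_p: "prime p"
    and nrm_of_rat: "nrm (of_rat q) = padic_abs p q"
    and complete: mcomplete
    and algebraic_closed:
      "0 < degree h \<Longrightarrow> (\<And>i. coeff h i \<in> algebraic_elements) \<Longrightarrow>
         \<exists>x\<in>algebraic_elements. poly h x = 0"
    and algebraic_dense: "mtopology closure_of algebraic_elements = UNIV"

section \<open>Balls and spheres\<close>

definition pball :: "('a::field_char_0 \<Rightarrow> real) \<Rightarrow> real \<Rightarrow> 'a \<Rightarrow> 'a set" where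
  "pball nrm r c = {x. nrm (x - c) < r}"

definition psphere :: "('a::field_char_0 \<Rightarrow> real) \<Rightarrow> real \<Rightarrow> 'a \<Rightarrow> 'a set" where
  "psphere nrm r c = {x. nrm (x - c) = r}"

section \<open>The dynamical system\<close>

definition pole :: "'a::field_char_0 \<Rightarrow> 'a \<Rightarrow> 'a" where
  "pole a b = - b / a"

text \<open>Division by zero gives \<open>dynf a b (pole a b) = 0\<close>, a value without meaning. An iterate is only
  meaningful under \<open>iterate_defined\<close>.\<close>

definition dynf :: "'a::field_char_0 \<Rightarrow> 'a \<Rightarrow> 'a \<Rightarrow> 'a" where
  "dynf a b x = (x ^ 3 + a * x ^ 2 + b * x) / (a * x + b)"

definition iterate_defined :: "'a::field_char_0 \<Rightarrow> 'a \<Rightarrow> nat \<Rightarrow> 'a \<Rightarrow> bool" where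
  "iterate_defined a b n x \<longleftrightarrow> (\<forall>k<n. (dynf a b ^^ k) x \<noteq> pole a b)"

definition bad_set :: "'a::field_char_0 \<Rightarrow> 'a \<Rightarrow> 'a set" where
  "bad_set a b = {x. \<exists>n. iterate_defined a b n x \<and> (dynf a b ^^ n) x = pole a b}"

lemma iterate_defined_if_notin_bad_set:
  assumes "x \<notin> bad_set a b"
  shows "iterate_defined a b n x"
proof (induction n)
  case 0
  show ?case by (simp add: iterate_defined_def)
next
  case (Suc n)
  have "(dynf a b ^^ n) x \<noteq> pole a b"
    using assms Suc by (auto simp: bad_set_def)
  with Suc show ?case
    unfolding iterate_defined_def less_Suc_eq by blast
qed

definition invariant_sphere ::
  "('a::field_char_0 \<Rightarrow> real) \<Rightarrow> 'a \<Rightarrow> 'a \<Rightarrow> real \<Rightarrow> bool" where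
  "invariant_sphere nrm a b \<rho> \<longleftrightarrow>
     (\<forall>x\<in>psphere nrm \<rho> 0. \<forall>n\<ge>1. iterate_defined a b n x \<and> (dynf a b ^^ n) x \<in> psphere nrm \<rho> 0)"

definition Siegel_disk ::
  "('a::field_char_0 \<Rightarrow> real) \<Rightarrow> 'a \<Rightarrow> 'a \<Rightarrow> real \<Rightarrow> bool" where
  "Siegel_disk nrm a b r \<longleftrightarrow> 0 < r \<and> (\<forall>\<rho>\<ge>0. \<rho> < r \<longrightarrow> invariant_sphere nrm a b \<rho>)"

definition SI :: "('a::field_char_0 \<Rightarrow> real) \<Rightarrow> 'a \<Rightarrow> 'a \<Rightarrow> 'a set" where
  "SI nrm a b = \<Union> {pball nrm r 0 | r. Siegel_disk nrm a b r}"

end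

theory Submission
  imports Defs
begin

text \<open>Since \<open>b = x\<^sub>1 x\<^sub>2\<close>, the assumption gives \<open>|b| = |a|\<^sup>2 = \<alpha>\<^sup>2\<close>. The ultrametric inequality then decides
  which term dominates in \<open>x (x\<^sup>2 + a x + b) / (a x + b)\<close>: for \<open>|x| < \<alpha>\<close> it is \<open>b\<close> in both factors, so
  \<open>|f(x)| = |x|\<close>; for \<open>|x| > \<alpha>\<close> these are \<open>x\<^sup>2\<close> and \<open>a x\<close>, so \<open>|f(x)| = |x|\<^sup>2 / \<alpha>\<close> and the orbit escapes.
  The pole itself lies on the sphere of radius \<open>\<alpha>\<close>, which is therefore not invariant.\<close>

context nonarchimedean_field
begin

text \<open>Writing \<open>x\<close> as \<open>(x + y) + (- y)\<close>, the ultrametric inequality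
  bounds \<open>nrm x\<close> by the larger of \<open>nrm (x + y)\<close> and \<open>nrm y\<close>;
  the latter is too small to be the bound.\<close>

lemma nrm_add_eq_left:
  assumes "nrm y < nrm x"
  shows "nrm (x + y) = nrm x"
  using nrm_ultrametric[of x y] nrm_ultrametric[of "x + y" "- y"] nrm_minus[of y] assms
  by simp

lemma nrm_power: "nrm (x ^ n) = nrm x ^ n"
  by (induction n) (simp_all add: nrm_1 nrm_mult)

lemma nrm_divide: "nrm (x / y) = nrm x / nrm y"
proof (cases "y = 0")
  case True
  \<comment> \<open>Division by zero gives 0 both in the field and in the reals.\<close>
  then show ?thesis using nrm_eq_0_iff[of 0] by simp
next
  case False
  then have "nrm (x / y) * nrm y = nrm x" "nrm y \<noteq> 0"
    by (simp_all add: nrm_eq_0_iff flip: nrm_mult)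
  then show ?thesis by (simp add: field_simps)
qed

lemma nrm_dynf:
  "nrm (dynf a b x) = nrm x * nrm (x ^ 2 + a * x + b) / nrm (a * x + b)"
proof -
  have "x ^ 3 + a * x ^ 2 + b * x = x * (x ^ 2 + a * x + b)"
    by (simp add: algebra_simps power2_eq_square power3_eq_cube)
  then show ?thesis
    by (simp add: dynf_def nrm_divide nrm_mult)
qed

context
  fixes a b :: 'a
  assumes a_nonzero: "a \<noteq> 0" and nrm_b: "nrm b = nrm a ^ 2"
begin

lemma nrm_a_pos: "0 < nrm a"
  using a_nonzero nrm_nonneg[of a] nrm_eq_0_iff[of a] by simp

lemma nrm_pole: "nrm (pole a b) = nrm a"
  using nrm_a_pos by (simp add: pole_def nrm_minus nrm_divide nrm_b power2_eq_square)

lemma nrm_dynf_inside: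
  assumes "nrm x < nrm a"
  shows "nrm (dynf a b x) = nrm x"
proof -
  have ax: "nrm (a * x) < nrm b"
    using assms nrm_a_pos by (simp add: nrm_mult nrm_b power2_eq_square)
  moreover have "nrm (x ^ 2) < nrm b"
    using assms nrm_nonneg[of x] by (simp add: nrm_power nrm_b power_strict_mono)
  ultimately have "nrm (x ^ 2 + a * x) < nrm b"
    using nrm_ultrametric[of "x ^ 2" "a * x"] by simp
  then have "nrm (x ^ 2 + a * x + b) = nrm b"
    using nrm_add_eq_left[of "x ^ 2 + a * x" b] by (simp add: add.commute)
  moreover have "nrm (a * x + b) = nrm b"
    using nrm_add_eq_left[OF ax] by (simp add: add.commute)
  ultimately show ?thesis
    using nrm_a_pos by (simp add: nrm_dynf nrm_b)
qed

lemma nrm_dynf_outside: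
  assumes "nrm a < nrm x"
  shows "nrm (dynf a b x) = nrm x ^ 2 / nrm a"
proof -
  have "nrm b < nrm (a * x)"
    using assms nrm_a_pos by (simp add: nrm_mult nrm_b power2_eq_square)
  then have ax_b: "nrm (a * x + b) = nrm a * nrm x"
    by (simp add: nrm_add_eq_left nrm_mult)
  have "nrm (a * x + b) < nrm (x ^ 2)"
    using assms nrm_a_pos by (simp add: ax_b nrm_mult power2_eq_square)
  then have "nrm (x ^ 2 + a * x + b) = nrm x ^ 2"
    using nrm_add_eq_left[of "a * x + b" "x ^ 2"] by (simp add: nrm_power add.assoc)
  then show ?thesis
    using assms nrm_a_pos by (simp add: nrm_dynf ax_b power2_eq_square)
qed

lemma nrm_iterate_inside:
  assumes "nrm x < nrm a"
  shows "nrm ((dynf a b ^^ n) x) = nrm x"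
  using assms by (induction n) (simp_all add: nrm_dynf_inside)

text \<open>One step multiplies the norm of the current point \<open>y\<close> by
  \<open>nrm y / nrm a\<close>. Norms never drop below the initial one, so this factor is at least
  \<open>nrm x / nrm a > 1\<close>. The true growth is faster, but a geometric lower bound suffices
  for divergence.\<close>

lemma nrm_iterate_outside:
  assumes "nrm a < nrm x"
  shows "nrm x * (nrm x / nrm a) ^ n \<le> nrm ((dynf a b ^^ n) x)"
proof (induction n)
  case 0
  show ?case by simp
next
  case (Suc n)
  let ?y = "(dynf a b ^^ n) x" and ?q = "nrm x / nrm a"
  have q: "1 \<le> ?q" using assms nrm_a_pos by simp
  have "nrm x * 1 \<le> nrm x * ?q ^ n"
    by (intro mult_left_mono one_le_power q nrm_nonneg)
  with Suc have y: "nrm x \<le> nrm ?y" by simp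
  have "nrm x * ?q ^ Suc n = (nrm x * ?q ^ n) * ?q" by simp
  \<comment> \<open>The induction hypothesis bounds the first factor, and \<open>y\<close> bounds
    the second.\<close>
  also have "\<dots> \<le> nrm ?y * (nrm ?y / nrm a)"
    using Suc y q nrm_a_pos nrm_nonneg[of ?y] by (intro mult_mono divide_right_mono) auto
  also have "\<dots> = nrm ((dynf a b ^^ Suc n) x)"
    using assms y by (simp add: nrm_dynf_outside power2_eq_square)
  finally show ?case .
qed

lemma nrm_iterate_outside_gt:
  assumes "nrm a < nrm x"
  shows "nrm a < nrm ((dynf a b ^^ n) x)"
proof -
  have "nrm x * 1 \<le> nrm x * (nrm x / nrm a) ^ n"
    using assms nrm_a_pos by (intro mult_left_mono one_le_power nrm_nonneg) simp
  with nrm_iterate_outside[OF assms, of n] assms show ?thesis by simp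
qed

lemma filterlim_nrm_iterate_outside:
  assumes "nrm a < nrm x"
  shows "filterlim (\<lambda>n. nrm ((dynf a b ^^ n) x)) at_top sequentially"
proof -
  have "filterlim (\<lambda>n. (nrm x / nrm a) ^ n) at_top sequentially"
    using assms nrm_a_pos
    by (intro filterlim_at_infinity_imp_filterlim_at_top filterlim_realpow_sequentially_gt1) auto
  then have "filterlim (\<lambda>n. nrm x * (nrm x / nrm a) ^ n) at_top sequentially"
    using assms nrm_a_pos by (intro filterlim_tendsto_pos_mult_at_top[OF tendsto_const]) auto
  then show ?thesis
    by (rule filterlim_at_top_mono) (simp add: nrm_iterate_outside assms)
qed

text \<open>An orbit that starts off the sphere through the pole never meets it: inside, the norm is
  constant; outside, it stays above \<open>nrm a\<close>.\<close>

lemma bad_set_subset_psphere: "bad_set a b \<subseteq> psphere nrm (nrm a) 0"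
proof
  fix x assume "x \<in> bad_set a b"
  then obtain n where "(dynf a b ^^ n) x = pole a b"
    by (auto simp: bad_set_def)
  then have "nrm ((dynf a b ^^ n) x) = nrm a"
    by (simp add: nrm_pole)
  then have "nrm x = nrm a"
    using nrm_iterate_inside[of x n] nrm_iterate_outside_gt[of x n]
    by (cases "nrm x" "nrm a" rule: linorder_cases) auto
  then show "x \<in> psphere nrm (nrm a) 0"
    by (simp add: psphere_def)
qed

lemma Siegel_disk_iff: "Siegel_disk nrm a b r \<longleftrightarrow> 0 < r \<and> r \<le> nrm a"
proof
  assume r: "Siegel_disk nrm a b r"
  have "\<not> invariant_sphere nrm a b (nrm a)"
  proof
    assume "invariant_sphere nrm a b (nrm a)"
    \<comment> \<open>The pole is a point of this sphere, and already its first iterate is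
      undefined.\<close>
    then have "iterate_defined a b 1 (pole a b)"
      unfolding invariant_sphere_def by (auto simp: psphere_def nrm_pole)
    then show False
      by (auto simp: iterate_defined_def)
  qed
  with r show "0 < r \<and> r \<le> nrm a"
    using nrm_nonneg[of a] by (auto simp: Siegel_disk_def not_less[symmetric])
next
  assume r: "0 < r \<and> r \<le> nrm a"
  \<comment> \<open>Iterates are defined here because the bad set lies on the sphere of radius
    \<open>nrm a\<close>, hence outside these smaller spheres.\<close>
  have "invariant_sphere nrm a b \<rho>" if "\<rho> < r" for \<rho>
    using that r bad_set_subset_psphere
    by (auto simp: invariant_sphere_def psphere_def nrm_iterate_inside
        intro!: iterate_defined_if_notin_bad_set)
  with r show "Siegel_disk nrm a b r"
    by (simp add: Siegel_disk_def)
qed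

lemma SI_eq_pball: "SI nrm a b = pball nrm (nrm a) 0"
proof
  show "SI nrm a b \<subseteq> pball nrm (nrm a) 0"
    unfolding SI_def Siegel_disk_iff pball_def by auto
  \<comment> \<open>The extremal radius \<open>nrm a\<close> is itself admissible, so this ball is a
    member of the union.\<close>
  show "pball nrm (nrm a) 0 \<subseteq> SI nrm a b"
    unfolding SI_def Siegel_disk_iff using nrm_a_pos by blast
qed

end

end

theorem theorem4:
  fixes p :: nat and nrm :: "'a::field_char_0 \<Rightarrow> real"
    and a b s x1 x2 :: 'a and \<delta> \<alpha> \<beta> :: real
  assumes "complex_padic_field p nrm"
    and "a * b \<noteq> 0"
    and "s ^ 2 = a ^ 2 - 4 * b"
    and "x1 = (- a + s) / 2" and "x2 = (- a - s) / 2"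
    and "\<delta> = nrm a" and "\<alpha> = nrm x1" and "\<beta> = nrm x2"
    and "\<delta> = \<alpha>" and "\<alpha> = \<beta>"
  shows "SI nrm a b = pball nrm \<alpha> 0 \<and> bad_set a b \<subseteq> psphere nrm \<alpha> 0
    \<and> (\<forall>x\<in>psphere nrm \<alpha> 0 - bad_set a b.
         (nrm (dynf a b x) = \<alpha> \<longrightarrow> dynf a b x \<in> psphere nrm \<alpha> 0) \<and>
         (nrm (dynf a b x) < \<alpha> \<longrightarrow> (\<forall>n\<ge>1. (dynf a b ^^ n) x \<in> psphere nrm (nrm (dynf a b x)) 0)))
    \<and> (\<forall>r\<ge>\<alpha>. \<forall>x\<in>psphere nrm r 0 - bad_set a b. nrm (dynf a b x) > \<alpha> \<longrightarrow>
         filterlim (\<lambda>n. nrm ((dynf a b ^^ n) x)) at_top sequentially)"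
proof -
  interpret complex_padic_field p nrm by fact
  have a: "a \<noteq> 0" using assms(2) by simp
  have radius: "\<alpha> = nrm a" using assms by simp
  have "x1 * x2 = (a ^ 2 - s ^ 2) / 4"
    by (simp add: assms(4,5) field_simps power2_eq_square)
  then have "x1 * x2 = b"
    by (simp add: assms(3))
  then have b: "nrm b = nrm a ^ 2"
    using nrm_mult[of x1 x2] assms(6-10) by (simp add: power2_eq_square)
  have "(dynf a b ^^ n) x \<in> psphere nrm (nrm (dynf a b x)) 0"
    if y: "nrm (dynf a b x) < nrm a" and n: "n \<ge> 1" for x n
  proof -
    \<comment> \<open>The first step lands at \<open>dynf a b x\<close> inside the ball; the
      remaining \<open>m\<close> steps preserve its norm.\<close>
    obtain m where "n = Suc m" using n by (cases n) auto
    then show ?thesis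
      using nrm_iterate_inside[OF a b y, of m]
      by (simp add: psphere_def funpow_Suc_right del: funpow.simps)
  qed
  moreover have "filterlim (\<lambda>n. nrm ((dynf a b ^^ n) x)) at_top sequentially"
    if "nrm (dynf a b x) > nrm a" for x
  proof -
    \<comment> \<open>This is the orbit of \<open>dynf a b x\<close>, which starts outside; shifting
      the index by one does not affect the limit.\<close>
    have "filterlim (\<lambda>n. nrm ((dynf a b ^^ Suc n) x)) at_top sequentially"
      using filterlim_nrm_iterate_outside[OF a b that]
      by (simp add: funpow_Suc_right del: funpow.simps)
    then show ?thesis
      by (rule filterlim_sequentially_Suc[THEN iffD1])
  qed
  ultimately show ?thesis
    using SI_eq_pball[OF a b] bad_set_subset_psphere[OF a b]
    by (simp add: radius psphere_def)
qed

end
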